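(* For all positive integers $m,n$ with $m\le n$, $$\chi_o(K_{m,n})=m+\min\{n,2^m\}\quad\text{and}\quad \chi_o^+(K_{m,n})\le m+2^m.$$
   Context: All graphs are finite and simple. An oriented graph is a digraph with no loops, no multiple arcs and no pair of opposite arcs; an orientation of an undirected graph $G$ is obtained by giving each edge one of its two directions. A homomorphism between oriented graphs is a vertex map sending arcs to arcs. The oriented chromatic number $\chi_o(\vec G)$ of an oriented graph $\vec G$ is the smallest order of an oriented graph $\vec T$ with a homomorphism $\vec G\to\vec T$; for an undirected graph $G$, $\chi_o(G)$ is the maximum of $\chi_o(\vec G)$ over all orientations $\vec G$ of $G$. The upper oriented chromatic number $\chi_o^+(G)$ is the smallest order of an oriented graph $\vec T$ such that every orientation of $G$ admits a homomorphism to $\vec T$. $K_{m,n}$ is the complete bipartite graph with parts of sizes $m$ and $n$. *)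

theory Defs
  imports "Graph_Theory.Kuratowski" "HOL-Library.FuncSet"
begin

text \<open>
  Undirected graphs are symmetric loop-free finite digraphs (\<^locale>\<open>pair_graph\<close>),
  an edge being a pair of opposite arcs.
\<close>

definition oriented_graph :: "'a pair_pre_digraph \<Rightarrow> bool" where
  "oriented_graph D \<longleftrightarrow> pair_digraph D \<and> asym (parcs D)"

definition orientations :: "'a pair_pre_digraph \<Rightarrow> 'a pair_pre_digraph set" where
  "orientations G = {D. pverts D = pverts G \<and> parcs D \<subseteq> parcs G \<and>
     (\<forall>(u, v) \<in> parcs G. ((u, v) \<in> parcs D) \<noteq> ((v, u) \<in> parcs D))}"

definition digraph_hom ::
    "('a \<Rightarrow> 'b) \<Rightarrow> 'a pair_pre_digraph \<Rightarrow> 'b pair_pre_digraph \<Rightarrow> bool" where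
  "digraph_hom f D T \<longleftrightarrow> f \<in> pverts D \<rightarrow> pverts T \<and>
     (\<forall>(u, v) \<in> parcs D. (f u, f v) \<in> parcs T)"

text \<open>
  Targets are taken with natural numbers as vertices; by \<open>digraph_hom_to_nat\<close> below
  this does not restrict the orders that occur.
\<close>

definition oriented_chromatic_number :: "'a pair_pre_digraph \<Rightarrow> nat" where
  "oriented_chromatic_number D = (LEAST k. \<exists>T :: nat pair_pre_digraph.
     oriented_graph T \<and> card (pverts T) = k \<and> (\<exists>f. digraph_hom f D T))"

definition chi_o :: "'a pair_pre_digraph \<Rightarrow> nat" where
  "chi_o G = Max (oriented_chromatic_number ` orientations G)"

definition chi_o_plus :: "'a pair_pre_digraph \<Rightarrow> nat" where
  "chi_o_plus G = (LEAST k. \<exists>T :: nat pair_pre_digraph.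
     oriented_graph T \<and> card (pverts T) = k \<and>
     (\<forall>D \<in> orientations G. \<exists>f. digraph_hom f D T))"

lemma oriented_graph_orientations:
  assumes "pair_graph G" "D \<in> orientations G"
  shows "oriented_graph D"
proof -
  interpret pair_graph G by fact
  have D: "pverts D = pverts G" "parcs D \<subseteq> parcs G"
    "\<And>u v. (u, v) \<in> parcs G \<Longrightarrow> ((u, v) \<in> parcs D) \<noteq> ((v, u) \<in> parcs D)"
    using assms(2) by (auto simp: orientations_def)
  have G: "u \<in> pverts G" "v \<in> pverts G" "u \<noteq> v" if "(u, v) \<in> parcs D" for u v
    using that D(2) in_arcsD1 in_arcsD2 pair_no_loops by fastforce+
  have "pair_digraph D"
    by unfold_locales
      (use D(1,2) G pair_finite_verts in \<open>auto intro: finite_subset[OF _ pair_finite_arcs]\<close>)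
  moreover have "asym (parcs D)"
    using D by (blast intro: asymI)
  ultimately show ?thesis by (simp add: oriented_graph_def)
qed

lemma digraph_hom_to_nat:
  fixes T :: "'b pair_pre_digraph"
  assumes "oriented_graph T"
  obtains T' :: "nat pair_pre_digraph" and h where
    "oriented_graph T'" "card (pverts T') = card (pverts T)"
    "\<And>(f :: 'a \<Rightarrow> 'b) D. digraph_hom f D T \<Longrightarrow> digraph_hom (h \<circ> f) D T'"
proof -
  interpret pair_digraph T using assms by (simp add: oriented_graph_def)
  have asym: "\<And>u v. (u, v) \<in> parcs T \<Longrightarrow> (v, u) \<notin> parcs T"
    using assms by (auto simp: oriented_graph_def dest: asymD)
  obtain h :: "'b \<Rightarrow> nat" where h: "inj_on h (pverts T)"
    using finite_imp_inj_to_nat_seg[OF pair_finite_verts] by blast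
  define T' where "T' = \<lparr>pverts = h ` pverts T, parcs = map_prod h h ` parcs T\<rparr>"
  have T'[simp]: "pverts T' = h ` pverts T" "parcs T' = map_prod h h ` parcs T"
    by (simp_all add: T'_def)
  have eq: "h u = h v \<Longrightarrow> u \<in> pverts T \<Longrightarrow> v \<in> pverts T \<Longrightarrow> u = v" for u v
    using h by (auto dest: inj_onD)
  have G: "u \<in> pverts T" "v \<in> pverts T" "h u \<noteq> h v" if "(u, v) \<in> parcs T" for u v
    using that in_arcsD1 in_arcsD2 pair_no_loops eq by fastforce+
  have "pair_digraph T'"
    by unfold_locales (use G pair_finite_verts pair_finite_arcs in auto)
  moreover have "asym (parcs T')"
  proof (rule asymI, rule notI)
    fix x y assume "(x, y) \<in> parcs T'" "(y, x) \<in> parcs T'"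
    then obtain a b c d where *: "(a, b) \<in> parcs T" "(c, d) \<in> parcs T"
      "h a = h d" "h b = h c" by auto
    then have "a = d" "b = c" by (auto intro!: eq dest: in_arcsD1 in_arcsD2)
    with * asym show False by blast
  qed
  ultimately have "oriented_graph T'" by (simp add: oriented_graph_def)
  moreover have "card (pverts T') = card (pverts T)" using h by (simp add: card_image)
  moreover have "digraph_hom (h \<circ> f) D T'" if "digraph_hom f D T" for f :: "'a \<Rightarrow> 'b" and D
    using that by (force simp: digraph_hom_def)
  ultimately show thesis using that by blast
qed

end

theory Submission
  imports Defs
begin

text \<open>
  Let \<open>U\<close> be the part of size \<open>m\<close>. An orientation amounts to choosing, for every vertex \<open>v\<close> of
  the other part \<open>V\<close>, its in-neighbourhood, a subset of \<open>U\<close>. Hence every orientation maps to the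
  oriented graph on \<open>U\<close> together with all subsets of \<open>U\<close>, of order \<open>m + 2 ^ m\<close>. Conversely, let
  the in-neighbourhoods of the vertices in \<open>V\<close> range over a family of \<open>min n (2 ^ m)\<close> subsets that
  contains all singletons, which is possible since \<open>m \<le> n\<close>. A homomorphism to an oriented graph
  cannot identify two vertices joined by a directed path of length two: it is therefore injective
  on \<open>U\<close>, because of the singletons, and separates vertices of \<open>V\<close> with different
  in-neighbourhoods.
\<close>

lemma digraph_hom_id: "digraph_hom id D D" if "pair_digraph D"
  by (auto simp: digraph_hom_def)

text \<open>The definition admits only targets on natural numbers; relabelling by
  \<open>digraph_hom_to_nat\<close> lets a target over any vertex type bound it, such as
  \<open>D\<close> itself or \<open>subset_target\<close>.\<close>

lemma oriented_chromatic_number_le: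
  fixes D :: "'a pair_pre_digraph" and T :: "'b pair_pre_digraph"
  assumes "oriented_graph T" "digraph_hom f D T"
  shows "oriented_chromatic_number D \<le> card (pverts T)"
proof -
  obtain T' :: "nat pair_pre_digraph" and h where "oriented_graph T'"
    "card (pverts T') = card (pverts T)"
    "\<And>(f :: 'a \<Rightarrow> 'b) D. digraph_hom f D T \<Longrightarrow> digraph_hom (h \<circ> f) D T'"
    by (rule digraph_hom_to_nat[OF assms(1)]) (rule that)
  with assms(2) show ?thesis
    unfolding oriented_chromatic_number_def by (intro Least_le) blast
qed

text \<open>The minimum in the definition is attained because \<open>D\<close>, relabelled by
  naturals, is itself a target; the bound is then applied to an optimal target.\<close>

lemma le_oriented_chromatic_number:
  fixes D :: "'a pair_pre_digraph"
  assumes "oriented_graph D"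
    and "\<And>(T :: nat pair_pre_digraph) f. oriented_graph T \<Longrightarrow> digraph_hom f D T \<Longrightarrow> k \<le> card (pverts T)"
  shows "k \<le> oriented_chromatic_number D"
proof -
  obtain T' :: "nat pair_pre_digraph" and h where "oriented_graph T'"
    "card (pverts T') = card (pverts D)"
    "\<And>(f :: 'a \<Rightarrow> 'a) E. digraph_hom f E D \<Longrightarrow> digraph_hom (h \<circ> f) E T'"
    by (rule digraph_hom_to_nat[OF assms(1)]) (rule that)
  moreover have "digraph_hom id D D"
    using assms(1) digraph_hom_id by (auto simp: oriented_graph_def)
  ultimately have "\<exists>k (T :: nat pair_pre_digraph).
      oriented_graph T \<and> card (pverts T) = k \<and> (\<exists>f. digraph_hom f D T)"
    by blast
  from LeastI_ex[OF this] show ?thesis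
    unfolding oriented_chromatic_number_def[symmetric] using assms(2) by metis
qed

lemma chi_o_plus_le:
  fixes G :: "'a pair_pre_digraph" and T :: "'b pair_pre_digraph"
  assumes "oriented_graph T" "\<And>D. D \<in> orientations G \<Longrightarrow> \<exists>f. digraph_hom f D T"
  shows "chi_o_plus G \<le> card (pverts T)"
proof -
  obtain T' :: "nat pair_pre_digraph" and h where "oriented_graph T'"
    "card (pverts T') = card (pverts T)"
    "\<And>(f :: 'a \<Rightarrow> 'b) D. digraph_hom f D T \<Longrightarrow> digraph_hom (h \<circ> f) D T'"
    by (rule digraph_hom_to_nat[OF assms(1)]) (rule that)
  with assms(2) show ?thesis
    unfolding chi_o_plus_def by (intro Least_le) blast
qed

text \<open>Gives meaning to the \<open>Max\<close> in \<open>chi_o\<close>. With the vertex set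
  fixed, an orientation is determined by its set of arcs.\<close>

lemma finite_orientations:
  assumes "pair_graph G"
  shows "finite (orientations G)"
proof -
  interpret pair_graph G by fact
  have "orientations G \<subseteq> (\<lambda>A. \<lparr>pverts = pverts G, parcs = A\<rparr>) ` Pow (parcs G)"
  proof
    fix D assume "D \<in> orientations G"
    then have "D = \<lparr>pverts = pverts G, parcs = parcs D\<rparr>" "parcs D \<in> Pow (parcs G)"
      by (simp_all add: orientations_def)
    then show "D \<in> (\<lambda>A. \<lparr>pverts = pverts G, parcs = A\<rparr>) ` Pow (parcs G)"
      by (rule image_eqI)
  qed
  then show ?thesis
    using pair_finite_arcs finite_subset by blast
qed

text \<open>Identifying the two ends of a directed path of length two would put a pair of opposite
  arcs into \<open>T\<close>.\<close>

lemma digraph_hom_dipath2_neq: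
  assumes "oriented_graph T" "digraph_hom f D T" "(u, v) \<in> parcs D" "(v, w) \<in> parcs D"
  shows "f u \<noteq> f w"
proof
  assume "f u = f w"
  then have "(f u, f v) \<in> parcs T" "(f v, f u) \<in> parcs T"
    using assms(2-4) by (auto simp: digraph_hom_def)
  with assms(1) show False
    by (auto simp: oriented_graph_def dest: asymD)
qed

lemma digraph_hom_arc_neq:
  assumes "oriented_graph T" "digraph_hom f D T" "(u, v) \<in> parcs D"
  shows "f u \<noteq> f v"
proof
  assume "f u = f v"
  then have "(f u, f u) \<in> parcs T"
    using assms(2,3) by (auto simp: digraph_hom_def)
  with assms(1) show False
    by (auto simp: oriented_graph_def dest: asymD)
qed

definition bipartite_orientation :: "'a set \<Rightarrow> 'a set \<Rightarrow> ('a \<Rightarrow> 'a \<Rightarrow> bool) \<Rightarrow> 'a pair_pre_digraph"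
  where "bipartite_orientation U V R = \<lparr>pverts = U \<union> V,
    parcs = {(u, v). u \<in> U \<and> v \<in> V \<and> R u v} \<union> {(v, u). u \<in> U \<and> v \<in> V \<and> \<not> R u v}\<rparr>"

lemma pverts_bipartite_orientation [simp]: "pverts (bipartite_orientation U V R) = U \<union> V"
  by (simp add: bipartite_orientation_def)

lemma parcs_bipartite_orientation:
  "(x, y) \<in> parcs (bipartite_orientation U V R) \<longleftrightarrow>
    x \<in> U \<and> y \<in> V \<and> R x y \<or> y \<in> U \<and> x \<in> V \<and> \<not> R y x"
  by (auto simp: bipartite_orientation_def)

lemma oriented_graph_bipartite_orientation:
  assumes "finite U" "finite V" "U \<inter> V = {}"
  shows "oriented_graph (bipartite_orientation U V R)" (is "oriented_graph ?D")
proof -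
  have "parcs ?D \<subseteq> (U \<union> V) \<times> (U \<union> V)"
    by (auto simp: bipartite_orientation_def)
  then have "finite (parcs ?D)"
    using assms(1,2) finite_subset by blast
  then have "pair_digraph ?D"
    by unfold_locales (use assms in \<open>auto simp: parcs_bipartite_orientation\<close>)
  moreover have "asym (parcs ?D)"
    using assms(3) by (intro asymI) (auto simp: parcs_bipartite_orientation)
  ultimately show ?thesis by (simp add: oriented_graph_def)
qed

lemma bipartite_orientation_in_orientations:
  assumes "pverts G = U \<union> V" "U \<inter> V = {}" "parcs G = U \<times> V \<union> V \<times> U"
  shows "bipartite_orientation U V R \<in> orientations G"
  using assms by (auto simp: orientations_def parcs_bipartite_orientation)

text \<open>The universal target: a subset of \<open>U\<close> stands for a vertex whose
  in-neighbourhood it is. The sum type keeps the two parts disjoint.\<close>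

definition subset_target :: "'a set \<Rightarrow> ('a + 'a set) pair_pre_digraph" where
  "subset_target U =
    bipartite_orientation (Inl ` U) (Inr ` Pow U) (\<lambda>x y. projl x \<in> projr y)"

lemma oriented_graph_subset_target: "finite U \<Longrightarrow> oriented_graph (subset_target U)"
  unfolding subset_target_def by (intro oriented_graph_bipartite_orientation) auto

lemma card_pverts_subset_target:
  assumes "finite U"
  shows "card (pverts (subset_target U)) = card U + 2 ^ card U"
  unfolding subset_target_def pverts_bipartite_orientation using assms
  by (subst card_Un_disjoint) (auto simp: card_image card_Pow)

text \<open>Each vertex of \<open>V\<close> goes to its own in-neighbourhood, so arc directions are
  preserved by construction. The target does not depend on \<open>D\<close>, as
  \<open>chi_o_plus\<close> demands.\<close>

lemma digraph_hom_subset_target: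
  assumes "pverts G = U \<union> V" "U \<inter> V = {}" "parcs G = U \<times> V \<union> V \<times> U"
    and "D \<in> orientations G"
  shows "digraph_hom (\<lambda>x. if x \<in> U then Inl x else Inr {u \<in> U. (u, x) \<in> parcs D})
    D (subset_target U)"
proof -
  have D: "pverts D = U \<union> V" "parcs D \<subseteq> U \<times> V \<union> V \<times> U"
    "\<And>u v. u \<in> U \<Longrightarrow> v \<in> V \<Longrightarrow> ((u, v) \<in> parcs D) \<noteq> ((v, u) \<in> parcs D)"
    using assms by (auto simp: orientations_def)
  show ?thesis
    unfolding digraph_hom_def
  proof (intro conjI ballI, goal_cases)
    case 1
    show ?case using D(1) by (auto simp: subset_target_def)
  next
    case (2 e)
    obtain x y where e: "e = (x, y)" by fastforce
    with 2 D(2) consider "x \<in> U" "y \<in> V" | "x \<in> V" "y \<in> U" by blast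
    then show ?case
    proof cases
      case 1
      then have "y \<notin> U" using assms(2) by blast
      with 1 2 e show ?thesis by (auto simp: subset_target_def parcs_bipartite_orientation)
    next
      case 2
      then have "x \<notin> U" "(y, x) \<notin> parcs D"
        using assms(2) D(3) \<open>e \<in> parcs D\<close> e by blast+
      with 2 e show ?thesis by (auto simp: subset_target_def parcs_bipartite_orientation)
    qed
  qed
qed

text \<open>The images of \<open>U\<close> and \<open>V\<close> are disjoint, since every vertex of
  \<open>U\<close> is adjacent to every vertex of \<open>V\<close>; hence their sizes may be bounded
  separately and added.\<close>

lemma card_hom_image_ge:
  fixes N :: "'a \<Rightarrow> 'a set"
  assumes "finite U" "finite V" "U \<inter> V = {}"
    and sub: "N ` V \<subseteq> Pow U" and sing: "(\<lambda>u. {u}) ` U \<subseteq> N ` V"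
    and T: "oriented_graph T"
    and f: "digraph_hom f (bipartite_orientation U V (\<lambda>u v. u \<in> N v)) T"
  shows "card U + card (N ` V) \<le> card (pverts T)"
proof -
  let ?D = "bipartite_orientation U V (\<lambda>u v. u \<in> N v)"
  note arcs = parcs_bipartite_orientation
  have "inj_on f U"
  proof (rule inj_onI, rule ccontr)
    fix u w assume *: "u \<in> U" "w \<in> U" "f u = f w" "u \<noteq> w"
    then have "{u} \<in> N ` V" using sing by blast
    then obtain v where "v \<in> V" "{u} = N v" by blast
    \<comment> \<open>As \<open>w\<close> differs from \<open>u\<close>, it lies outside
      \<open>N v\<close>, so \<open>v\<close> is the middle of a directed path from \<open>u\<close>
      to \<open>w\<close>.\<close>
    with * have "(u, v) \<in> parcs ?D" "(v, w) \<in> parcs ?D" by (auto simp: arcs)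
    from digraph_hom_dipath2_neq[OF T f this] *(3) show False by simp
  qed
  then have U: "card (f ` U) = card U" by (rule card_image)
  have less: "\<not> (u \<in> N v \<and> u \<notin> N w)" if "v \<in> V" "w \<in> V" "f v = f w" for u v w
  proof
    assume u: "u \<in> N v \<and> u \<notin> N w"
    with that sub have "u \<in> U" by blast
    with u that have "(w, u) \<in> parcs ?D" "(u, v) \<in> parcs ?D" by (auto simp: arcs)
    from digraph_hom_dipath2_neq[OF T f this] that(3) show False by simp
  qed
  have "N v = N w" if "v \<in> V" "w \<in> V" "f v = f w" for v w
    using less[OF that] less[OF that(2,1) that(3)[symmetric]] by blast
  \<comment> \<open>On \<open>V\<close> the map \<open>N\<close> factors through \<open>f\<close>,
    so \<open>N\<close> V\<open>is an image of\<close>f \<open>V\<close>.\<close>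
  then have "N v = N (inv_into V f (f v))" if "v \<in> V" for v
    using that by (metis imageI inv_into_into f_inv_into_f)
  then have "N ` V \<subseteq> (\<lambda>y. N (inv_into V f y)) ` f ` V"
    by blast
  then have V: "card (N ` V) \<le> card (f ` V)"
    using assms(2) by (intro surj_card_le) auto
  have "f u \<noteq> f v" if "u \<in> U" "v \<in> V" for u v
  proof -
    have "(u, v) \<in> parcs ?D \<or> (v, u) \<in> parcs ?D" using that unfolding arcs by blast
    then show ?thesis using digraph_hom_arc_neq[OF T f] by metis
  qed
  then have "card (f ` U \<union> f ` V) = card (f ` U) + card (f ` V)"
    using assms(1,2) by (intro card_Un_disjoint) blast+
  moreover have "f ` U \<union> f ` V \<subseteq> pverts T"
    using f by (auto simp: digraph_hom_def)
  moreover have "finite (pverts T)"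
  proof -
    interpret pair_digraph T using T by (simp add: oriented_graph_def)
    show ?thesis by (rule pair_finite_verts)
  qed
  ultimately show ?thesis
    using U V card_mono[of "pverts T" "f ` U \<union> f ` V"] by linarith
qed

lemma ex_image_eq:
  assumes "finite F" "finite V" "F \<noteq> {}" "card F \<le> card V"
  obtains N where "N ` V = F"
proof -
  obtain h where h: "inj_on h F" "h ` F \<subseteq> V"
    using card_le_inj[OF assms(1,2,4)] by blast
  obtain c where "c \<in> F" using assms(3) by blast
  \<comment> \<open>\<open>N\<close> inverts the injection \<open>h\<close> from \<open>F\<close>
    into \<open>V\<close>; the default \<open>c\<close> is taken in \<open>F\<close> so that the
    image does not leave \<open>F\<close>.\<close>
  define N where "N v = (if v \<in> h ` F then inv_into F h v else c)" for v
  have "N ` V \<subseteq> F"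
    using \<open>c \<in> F\<close> by (auto simp: N_def inv_into_into)
  moreover have "x \<in> N ` V" if "x \<in> F" for x
    using that h by (intro image_eqI[of _ _ "h x"]) (auto simp: N_def)
  ultimately show thesis using that by blast
qed

lemma ex_family_with_singletons:
  fixes U :: "'a set"
  assumes "finite U" "finite V" "U \<noteq> {}" "card U \<le> card V"
  obtains N where "N ` V \<subseteq> Pow U" "(\<lambda>u. {u}) ` U \<subseteq> N ` V"
    "card (N ` V) = min (card V) (2 ^ card U)"
proof -
  let ?k = "min (card V) (2 ^ card U)"
  \<comment> \<open>Both \<open>card U \<le> card V\<close> and \<open>card U < 2 ^ card U\<close>
    hold, so there is room for a family of size \<open>?k\<close> between the singletons and the
    full power set.\<close>
  have "card ((\<lambda>u. {u}) ` U) \<le> ?k" "?k \<le> card (Pow U)"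
    using assms(1,4) by (auto simp: card_image card_Pow less_exp[THEN less_imp_le])
  then obtain F where F: "(\<lambda>u. {u}) ` U \<subseteq> F" "F \<subseteq> Pow U" "card F = ?k"
    using exists_subset_between[of "(\<lambda>u. {u}) ` U" ?k "Pow U"] assms(1) by auto
  have "finite F" using F(2) assms(1) by (auto intro: finite_subset)
  moreover have "F \<noteq> {}" using F(1) assms(3) by blast
  ultimately obtain N where "N ` V = F"
    using ex_image_eq assms(2) F(3) by (metis min.cobounded1)
  with F that show thesis by blast
qed

theorem theorem2:
  fixes m n :: nat and G :: "'a pair_pre_digraph"
  assumes "1 \<le> m" and "m \<le> n"
    and "K\<^bsub>m,n\<^esub> (with_proj G)"
  shows "chi_o G = m + min n (2 ^ m) \<and> chi_o_plus G \<le> m + 2 ^ m"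
proof -
  have G: "pair_graph G" using assms(3) by (rule pair_graphI_complete_bipartite)
  obtain U V where UV: "pverts G = U \<union> V" "U \<inter> V = {}" "parcs G = U \<times> V \<union> V \<times> U"
    and card: "card U = m" "card V = n" and fin: "finite U" "finite V"
    using assms(3) unfolding complete_bipartite_digraph_pair_def by auto
  note hom = digraph_hom_subset_target[OF UV]
  \<comment> \<open>Two targets compete: \<open>D\<close> itself, of order \<open>m + n\<close>, and
    \<open>subset_target U\<close>, of order \<open>m + 2 ^ m\<close>. The smaller one yields the
    \<open>min\<close>.\<close>
  have ub: "oriented_chromatic_number D \<le> m + min n (2 ^ m)" if D: "D \<in> orientations G" for D
  proof -
    have "oriented_graph D" using G D by (rule oriented_graph_orientations)
    moreover from this have "digraph_hom id D D"
      by (intro digraph_hom_id) (simp add: oriented_graph_def)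
    ultimately have "oriented_chromatic_number D \<le> card (pverts D)"
      by (rule oriented_chromatic_number_le)
    also have "pverts D = U \<union> V"
      using D UV(1) by (simp add: orientations_def)
    also have "card (U \<union> V) = m + n"
      using card_Un_disjoint[OF fin UV(2)] card by simp
    finally show ?thesis
      using oriented_chromatic_number_le[OF oriented_graph_subset_target[OF fin(1)] hom[OF D]]
      by (simp add: card_pverts_subset_target fin card)
  qed
  have "U \<noteq> {}" using assms(1) card by auto
  then obtain N where N: "N ` V \<subseteq> Pow U" "(\<lambda>u. {u}) ` U \<subseteq> N ` V"
    "card (N ` V) = min n (2 ^ m)"
    using ex_family_with_singletons[OF fin] card assms(2) by metis
  let ?D = "bipartite_orientation U V (\<lambda>u v. u \<in> N v)"
  have D: "?D \<in> orientations G" using UV by (rule bipartite_orientation_in_orientations)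
  have "m + min n (2 ^ m) \<le> oriented_chromatic_number ?D"
    using oriented_graph_bipartite_orientation[OF fin UV(2)]
      card_hom_image_ge[OF fin UV(2) N(1,2)] N(3) card(1)
    by (intro le_oriented_chromatic_number) simp_all
  \<comment> \<open>The orientation built from \<open>N\<close> attains the upper bound, which is
    therefore the maximum over all orientations.\<close>
  with ub[OF D] have "oriented_chromatic_number ?D = m + min n (2 ^ m)" by linarith
  with D ub have "chi_o G = m + min n (2 ^ m)"
    unfolding chi_o_def using finite_orientations[OF G]
    by (intro Max_eqI) (auto simp: image_iff intro!: bexI[of _ ?D])
  moreover have "chi_o_plus G \<le> card (pverts (subset_target U))"
    using oriented_graph_subset_target[OF fin(1)] hom by (intro chi_o_plus_le) blast+
  then have "chi_o_plus G \<le> m + 2 ^ m"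
    using card_pverts_subset_target[OF fin(1)] card(1) by simp
  ultimately show ?thesis ..
qed

end
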